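(* Let $P^*$ be the kernel of any discrete-time birth-and-death chain on $\{0, \dots, d\}$, with birth probabilities $p^*_i$ and death probabilities $q^*_i$. (a) If $P^*$ has (strictly) positive eigenvalues, then $p^*_{i-1}+q^*_i<1$ for $1\le i\le d$. (b) If $P^*$ has nonnegative eigenvalues, then $P^*$ is monotone.
   Context: A birth-and-death kernel on $\{0,\dots,d\}$ with death, hold, birth probabilities $q^*_i,r^*_i,p^*_i$ is the tridiagonal stochastic matrix with $P^*(i,i-1)=q^*_i$, $P^*(i,i)=r^*_i$, $P^*(i,i+1)=p^*_i$, $q^*_0=0$, $p^*_d=0$. "Has positive (nonnegative) eigenvalues" means that all eigenvalues are positive (nonnegative). A kernel $P^*$ is monotone if $\sum_{k>j}P^*(i,k)$ is nondecreasing in $i$ for each $j$; for a birth-and-death kernel this is equivalent to $p^*_{i-1}+q^*_i\le1$ for $1\le i\le d$. *)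

theory Defs
  imports Complex_Main "Jordan_Normal_Form.Char_Poly"
begin

definition stochastic_mat :: "real mat \<Rightarrow> bool" where
  "stochastic_mat P \<longleftrightarrow> square_mat P \<and>
     (\<forall>i < dim_row P. \<forall>j < dim_row P. 0 \<le> P $$ (i, j)) \<and>
     (\<forall>i < dim_row P. (\<Sum>j < dim_row P. P $$ (i, j)) = 1)"

text \<open>The state space \<open>{0..d}\<close> has \<open>d + 1\<close> elements, which index the rows and columns from 0.
  The values \<open>q 0\<close> and \<open>p d\<close> are not entries of the matrix, hence the separate conditions;
  \<open>q\<close>, \<open>r\<close>, \<open>p\<close> are unconstrained beyond \<open>d\<close>.\<close>

definition birth_death_kernel ::
  "nat \<Rightarrow> (nat \<Rightarrow> real) \<Rightarrow> (nat \<Rightarrow> real) \<Rightarrow> (nat \<Rightarrow> real) \<Rightarrow> real mat \<Rightarrow> bool" where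
  "birth_death_kernel d q r p P \<longleftrightarrow>
     P \<in> carrier_mat (d + 1) (d + 1) \<and> stochastic_mat P \<and>
     (\<forall>i \<le> d. \<forall>j \<le> d. P $$ (i, j) =
        (if i = j + 1 then q i else if i = j then r i else if j = i + 1 then p i else 0)) \<and>
     q 0 = 0 \<and> p d = 0"

text \<open>Eigenvalues are taken over the complex numbers, so that all of them are accounted for.\<close>

definition has_positive_eigenvalues :: "real mat \<Rightarrow> bool" where
  "has_positive_eigenvalues P \<longleftrightarrow>
     (\<forall>z. eigenvalue (map_mat complex_of_real P) z \<longrightarrow> z \<in> \<real> \<and> 0 < Re z)"

definition has_nonneg_eigenvalues :: "real mat \<Rightarrow> bool" where
  "has_nonneg_eigenvalues P \<longleftrightarrow>
     (\<forall>z. eigenvalue (map_mat complex_of_real P) z \<longrightarrow> z \<in> \<real> \<and> 0 \<le> Re z)"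

definition monotone_kernel :: "real mat \<Rightarrow> bool" where
  "monotone_kernel P \<longleftrightarrow>
     (\<forall>j < dim_row P. \<forall>i i'. i \<le> i' \<longrightarrow> i' < dim_row P \<longrightarrow>
        (\<Sum>k \<in> {j<..<dim_row P}. P $$ (i, k)) \<le> (\<Sum>k \<in> {j<..<dim_row P}. P $$ (i', k)))"

end

theory Submission
  imports Defs
begin

text \<open>A tridiagonal determinant depends only on the diagonal and on the products of mirrored
  off-diagonal entries, so \<open>det (P + t I)\<close> is a continuant in \<open>r i + t\<close> and \<open>p i * q (i + 1) \<ge> 0\<close>.
  If it is positive for all \<open>t \<ge> s\<close>, so is every shorter leading continuant: at the last zero \<open>z\<close>
  of the one of order \<open>k\<close>, that of order \<open>k - 1\<close> is nonnegative by induction, so the recurrence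
  makes the one of order \<open>k + 1\<close> nonpositive at \<open>z\<close>. Cutting from the other end in the same
  way leaves the two-by-two minor \<open>(r i + t) * (r (i + 1) + t) - p i * q (i + 1) > 0\<close>.
  Take \<open>s = 0\<close> for positive eigenvalues and arbitrary \<open>s > 0\<close> for nonnegative ones; since
  \<open>r i \<le> 1 - p i\<close> and \<open>r (i + 1) \<le> 1 - q (i + 1)\<close>, the minor bounds \<open>p i + q (i + 1)\<close>.\<close>

section \<open>Continuants and tridiagonal determinants\<close>

text \<open>The \<open>n\<close>-by-\<open>n\<close> diagonal block starting at index \<open>i\<close>.\<close>

fun continuant :: "(nat \<Rightarrow> 'a::comm_ring_1) \<Rightarrow> (nat \<Rightarrow> 'a) \<Rightarrow> nat \<Rightarrow> nat \<Rightarrow> 'a" where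
  "continuant a b i 0 = 1"
| "continuant a b i (Suc 0) = a i"
| "continuant a b i (Suc (Suc n)) =
     a (i + Suc n) * continuant a b i (Suc n) - b (i + n) * continuant a b i n"

text \<open>Mirror image of the defining recurrence, needed to cut blocks from the front. Both
  shorter continuants in that recurrence expand at the front by induction, and the terms
  regroup.\<close>

lemma continuant_front:
  "continuant a b i (Suc (Suc n)) =
     a i * continuant a b (Suc i) (Suc n) - b i * continuant a b (Suc (Suc i)) n"
proof (induction n rule: less_induct)
  case (less n)
  consider "n = 0" | "n = 1" | k where "n = Suc (Suc k)"
    by (metis One_nat_def not0_implies_Suc)
  then show ?case
  proof cases
    case (3 k)
    have IH: "continuant a b i n =
          a i * continuant a b (Suc i) (Suc k) - b i * continuant a b (Suc (Suc i)) k"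
        "continuant a b i (Suc n) =
          a i * continuant a b (Suc i) n - b i * continuant a b (Suc (Suc i)) (Suc k)"
      using less[of k] less[of "Suc k"] 3 by (simp_all del: continuant.simps)
    have "continuant a b i (Suc (Suc n)) =
        a (i + Suc n) * continuant a b i (Suc n) - b (i + n) * continuant a b i n"
      by simp
    also have "\<dots> = a i * continuant a b (Suc i) (Suc n) - b i * continuant a b (Suc (Suc i)) n"
      unfolding IH using 3 by (simp add: algebra_simps)
    finally show ?thesis .
  qed (simp_all add: algebra_simps)
qed

lemma det_tridiagonal:
  fixes m :: "nat \<Rightarrow> nat \<Rightarrow> 'a::comm_ring_1"
  assumes tri: "\<And>i j. j + 1 < i \<or> i + 1 < j \<Longrightarrow> m i j = 0"
  shows "det (mat n n (\<lambda>(i, j). m i j)) =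
    continuant (\<lambda>i. m i i) (\<lambda>i. m i (Suc i) * m (Suc i) i) 0 n"
proof (induction n rule: less_induct)
  case (less n)
  let ?T = "\<lambda>n. mat n n (\<lambda>(i, j). m i j)"
  consider "n = 0" | "n = 1" | k where "n = Suc (Suc k)"
    by (metis One_nat_def not0_implies_Suc)
  then show ?case
  proof cases
    case 1
    then show ?thesis by (simp add: det_dim_zero)
  next
    case 2
    then show ?thesis by (simp add: det_single)
  next
    case (3 k)
    let ?A = "?T (Suc (Suc k))"
    \<comment> \<open>With the last row and the last but one column gone, the last column of
      \<open>?B\<close> keeps the single entry \<open>m k (Suc k)\<close>.\<close>
    let ?B = "mat_delete ?A (Suc k) k"
    have A: "?A \<in> carrier_mat (Suc (Suc k)) (Suc (Suc k))"
      by simp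
    have B: "?B \<in> carrier_mat (Suc k) (Suc k)"
      using mat_delete_carrier[OF A, of "Suc k" k] by simp
    have corner: "mat_delete ?A (Suc k) (Suc k) = ?T (Suc k)"
      by (rule eq_matI) (auto simp: mat_delete_def)
    have corner': "mat_delete ?B k k = ?T k"
      by (rule eq_matI) (auto simp: mat_delete_def)
    have zero: "?B $$ (i, k) = 0" if "i < k" for i
      using that by (auto simp: mat_delete_def intro!: tri)
    have "det ?B = (\<Sum>i<Suc k. ?B $$ (i, k) * cofactor ?B i k)"
      by (rule laplace_expansion_column[OF B]) simp
    also have "\<dots> = m k (Suc k) * det (?T k)"
      using zero by (simp add: cofactor_def corner') (simp add: mat_delete_def)
    finally have detB: "det ?B = m k (Suc k) * det (?T k)" .
    have "det ?A = (\<Sum>j<Suc (Suc k). ?A $$ (Suc k, j) * cofactor ?A (Suc k) j)"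
      by (rule laplace_expansion_row[OF A]) simp
    also have "\<dots> = m (Suc k) (Suc k) * det (?T (Suc k)) - m (Suc k) k * det ?B"
      using tri by (simp add: cofactor_def corner)
    finally show ?thesis
      using 3 less[of k] less[of "Suc k"] by (simp add: detB algebra_simps)
  qed
qed

section \<open>Positivity along three-term recurrences\<close>

text \<open>Points with \<open>g \<le> 0\<close> cannot lie arbitrarily far out, so those from
  \<open>s\<close> on form a compact set; \<open>z\<close> is its maximum. Continuity from the right
  gives \<open>0 \<le> g z\<close>.\<close>

lemma eventually_pos_last_zero:
  fixes g :: "real \<Rightarrow> real"
  assumes cont: "continuous_on UNIV g" and ev: "\<forall>\<^sub>F t in at_top. 0 < g t"
    and t: "s \<le> t" "g t \<le> 0"
  obtains z where "s \<le> z" "g z = 0" "\<And>u. z < u \<Longrightarrow> 0 < g u"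
proof -
  obtain N where N: "\<And>u. N \<le> u \<Longrightarrow> 0 < g u"
    using ev by (auto simp: eventually_at_top_linorder)
  let ?S = "{s..N} \<inter> g -` {..0}"
  have "compact ?S"
    by (intro compact_Int_closed compact_Icc closed_vimage cont) simp
  moreover have "t \<in> ?S"
    using t N[of t] by force
  ultimately obtain z where z: "z \<in> ?S" "\<And>u. u \<in> ?S \<Longrightarrow> u \<le> z"
    using compact_attains_sup[of ?S] by blast
  have pos: "0 < g u" if "z < u" for u
    using z(2)[of u] z(1) N[of u] that by force
  have "(g \<longlongrightarrow> g z) (at_right z)"
    using cont by (auto simp: continuous_on_def intro: tendsto_within_subset)
  then have "0 \<le> g z"
    by (rule tendsto_lowerbound) (auto simp: eventually_at_filter pos less_imp_le)
  with z(1) show ?thesis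
    by (intro that[of z] pos) auto
qed

text \<open>The three-term recurrence satisfied by the leading principal minors of \<open>J + t I\<close>, where
  \<open>J\<close> is tridiagonal with diagonal \<open>a\<close> and \<open>b k\<close> is the product of the two off-diagonal
  entries linking \<open>k\<close> and \<open>k + 1\<close>.\<close>

locale sturm_sequence =
  fixes f :: "nat \<Rightarrow> real \<Rightarrow> real" and a b :: "nat \<Rightarrow> real" and n :: nat
  assumes f0: "f 0 t = 1" and f1: "f (Suc 0) t = a 0 + t"
    and rec: "Suc (Suc k) \<le> n \<Longrightarrow>
      f (Suc (Suc k)) t = (a (Suc k) + t) * f (Suc k) t - b k * f k t"
    and b: "Suc (Suc k) \<le> n \<Longrightarrow> 0 \<le> b k"
begin

lemma continuous:
  assumes "k \<le> n"
  shows "continuous_on UNIV (f k)"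
  using \<open>k \<le> n\<close>
proof (induction k rule: less_induct)
  case (less k)
  consider "k = 0" | "k = 1" | j where "k = Suc (Suc j)"
    by (metis One_nat_def not0_implies_Suc)
  then show ?case
  proof cases
    case 1
    then have "f k = (\<lambda>t. 1)" using f0 by auto
    then show ?thesis by simp
  next
    case 2
    then have "f k = (\<lambda>t. a 0 + t)" using f1 by auto
    then show ?thesis by (auto intro!: continuous_intros)
  next
    case (3 j)
    have "f k = (\<lambda>t. (a (Suc j) + t) * f (Suc j) t - b j * f j t)"
      using rec[of j] 3 less.prems by auto
    moreover have "continuous_on UNIV (f j)" "continuous_on UNIV (f (Suc j))"
      using less 3 by auto
    ultimately show ?thesis by (auto intro!: continuous_intros)
  qed
qed

lemma eventually_pos:
  assumes "k \<le> n"
  shows "\<forall>\<^sub>F t in at_top. 0 < f k t"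
proof -
  \<comment> \<open>Positivity alone does not survive the subtracted term; the induction also
    carries growth in the index.\<close>
  have step: "Suc j \<le> n \<Longrightarrow> \<forall>\<^sub>F t in at_top. 0 < f j t \<and> f j t \<le> f (Suc j) t" for j
  proof (induction j)
    case 0
    show ?case
      using eventually_ge_at_top[of "1 - a 0"] by eventually_elim (simp add: f0 f1)
  next
    case (Suc j)
    have "\<forall>\<^sub>F t in at_top. 0 < f j t \<and> f j t \<le> f (Suc j) t"
      using Suc by simp
    then show ?case
      using eventually_ge_at_top[of "1 + b j - a (Suc j)"]
    proof eventually_elim
      case (elim t)
      \<comment> \<open>The threshold makes \<open>a (Suc j) + t\<close> at least
        \<open>1 + b j\<close>; the share \<open>b j\<close> absorbs the subtracted term.\<close>
      have "(1 + b j) * f (Suc j) t \<le> (a (Suc j) + t) * f (Suc j) t"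
        using elim by (intro mult_right_mono) auto
      moreover have "b j * f j t \<le> b j * f (Suc j) t"
        using elim b[of j] Suc.prems by (intro mult_left_mono) auto
      ultimately have "f (Suc j) t \<le> f (Suc (Suc j)) t"
        using rec[of j t] Suc.prems by (simp add: algebra_simps)
      then show ?case using elim by linarith
    qed
  qed
  show ?thesis
  proof (cases k)
    case 0
    then show ?thesis by (simp add: f0)
  next
    case (Suc j)
    show ?thesis
      using step[of j] Suc \<open>k \<le> n\<close> by (auto elim: eventually_mono)
  qed
qed

text \<open>Replaces interlacing of zeros, and tolerates \<open>b k = 0\<close>, where interlacing
  need not be strict.\<close>

lemma pos_le:
  assumes pos: "\<And>t. s \<le> t \<Longrightarrow> 0 < f n t"
    and "k \<le> n" "s \<le> t"
  shows "0 < f k t"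
proof -
  have down: "0 < f j t" if "Suc j \<le> n" "\<And>t. s \<le> t \<Longrightarrow> 0 < f (Suc j) t" "s \<le> t" for j s t
    using that
  proof (induction j arbitrary: s t)
    case 0
    show ?case by (simp add: f0)
  next
    case (Suc j)
    show ?case
    proof (rule ccontr)
      assume "\<not> 0 < f (Suc j) t"
      then have nonpos: "f (Suc j) t \<le> 0" by simp
      have le: "Suc j \<le> n" using Suc.prems(1) by simp
      obtain z where z: "s \<le> z" "f (Suc j) z = 0" "\<And>u. z < u \<Longrightarrow> 0 < f (Suc j) u"
        using eventually_pos_last_zero[OF continuous[OF le] eventually_pos[OF le] Suc.prems(3) nonpos]
        by blast
      \<comment> \<open>The induction hypothesis is used on the ray from \<open>u\<close>, hence the
        generalisation over \<open>s\<close>; at \<open>z\<close> only the limit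
        \<open>0 \<le> f j z\<close> remains.\<close>
      have "0 < f j u" if "z < u" for u
        using le z(3) that by (intro Suc.IH[of u u]) auto
      moreover have "(f j \<longlongrightarrow> f j z) (at_right z)"
        using continuous[of j] Suc.prems
        by (auto simp: continuous_on_def intro: tendsto_within_subset)
      ultimately have "0 \<le> f j z"
        by (intro tendsto_lowerbound[of "f j" _ "at_right z"])
          (auto simp: eventually_at_filter less_imp_le)
      then have "f (Suc (Suc j)) z \<le> 0"
        using rec[of j z] b[of j] Suc.prems z(2) by simp
      with Suc.prems(2)[OF z(1)] show False by simp
    qed
  qed
  have "\<forall>t\<ge>s. 0 < f k t"
    using \<open>k \<le> n\<close>
  proof (induction rule: inc_induct)
    case base
    show ?case using pos by blast
  next
    case (step m)
    then show ?case using down[of m s] by simp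
  qed
  then show ?thesis using \<open>s \<le> t\<close> by blast
qed


end

section \<open>Birth-and-death kernels: minors and monotonicity\<close>

lemma birth_death_kernelD:
  assumes "birth_death_kernel d q r p P"
  shows "P \<in> carrier_mat (Suc d) (Suc d)"
    and "\<And>i j. i \<le> d \<Longrightarrow> j \<le> d \<Longrightarrow> 0 \<le> P $$ (i, j)"
    and "\<And>i. i \<le> d \<Longrightarrow> (\<Sum>j<Suc d. P $$ (i, j)) = 1"
    and "\<And>i j. i \<le> d \<Longrightarrow> j \<le> d \<Longrightarrow> P $$ (i, j) =
      (if i = j + 1 then q i else if i = j then r i else if j = i + 1 then p i else 0)"
proof -
  show P: "P \<in> carrier_mat (Suc d) (Suc d)"
    using assms by (simp add: birth_death_kernel_def)
  have st: "stochastic_mat P"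
    using assms by (simp add: birth_death_kernel_def)
  show "0 \<le> P $$ (i, j)" if "i \<le> d" "j \<le> d" for i j
    using st P that by (simp add: stochastic_mat_def)
  show "(\<Sum>j<Suc d. P $$ (i, j)) = 1" if "i \<le> d" for i
    using st P that by (simp add: stochastic_mat_def)
  show "P $$ (i, j) =
      (if i = j + 1 then q i else if i = j then r i else if j = i + 1 then p i else 0)"
    if "i \<le> d" "j \<le> d" for i j
    using assms that by (simp add: birth_death_kernel_def)
qed

lemma birth_death_minor_pos:
  assumes bd: "birth_death_kernel d q r p P"
    and no_ev: "\<And>t. s \<le> t \<Longrightarrow> \<not> eigenvalue (map_mat complex_of_real P) (- complex_of_real t)"
    and i: "i < d" and "s \<le> t"
  shows "p i * q (Suc i) < (r i + t) * (r (Suc i) + t)"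
proof -
  let ?n = "Suc d"
  define b where "b = (\<lambda>j. p j * q (Suc j))"
  define K where "K = (\<lambda>i n t. continuant (\<lambda>j. r j + t) b i n)"
  note P = birth_death_kernelD(1)[OF bd] and nonneg = birth_death_kernelD(2)[OF bd]
    and ent = birth_death_kernelD(4)[OF bd]
  have b: "0 \<le> b j" if "j < d" for j
    using nonneg[of j "Suc j"] nonneg[of "Suc j" j] that by (simp add: ent b_def)
  have nonzero: "K 0 ?n t \<noteq> 0" if "s \<le> t" for t
  proof -
    \<comment> \<open>\<open>det_tridiagonal\<close> asks for zeros off the band at all indices, so
      \<open>m\<close> extends \<open>P + t I\<close> beyond the matrix.\<close>
    define m where "m = (\<lambda>i j. if i = j + 1 then q i else if i = j then r i + t
      else if j = i + 1 then p i else 0)"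
    let ?M = "mat ?n ?n (\<lambda>(i, j). m i j)"
    have "char_matrix (map_mat complex_of_real P) (- complex_of_real t) = map_mat complex_of_real ?M"
      by (rule eq_matI) (use P in \<open>auto simp: char_matrix_def m_def ent\<close>)
    then have "det (map_mat complex_of_real ?M) \<noteq> 0"
      using no_ev[OF that] eigenvalue_det[of "map_mat complex_of_real P" ?n "- complex_of_real t"] P
      by auto
    then have "det ?M \<noteq> 0"
      by (simp add: of_real_hom.hom_det)
    moreover have "det ?M = continuant (\<lambda>i. m i i) (\<lambda>i. m i (Suc i) * m (Suc i) i) 0 ?n"
      by (rule det_tridiagonal) (auto simp: m_def)
    ultimately show ?thesis
      by (simp add: K_def b_def m_def)
  qed
  interpret leading: sturm_sequence "K 0" r b ?n
    by unfold_locales (use b in \<open>auto simp: K_def\<close>)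
  have full: "0 < K 0 ?n t" if st: "s \<le> t" for t
  proof (rule ccontr)
    assume "\<not> 0 < K 0 ?n t"
    then have nonpos: "K 0 ?n t \<le> 0" by simp
    obtain z where "s \<le> z" "K 0 ?n z = 0"
      using eventually_pos_last_zero[OF leading.continuous[OF order_refl]
          leading.eventually_pos[OF order_refl] st nonpos] by blast
    with nonzero show False by blast
  qed
  have leading: "0 < K 0 (Suc (Suc i)) t" if "s \<le> t" for t
    by (rule leading.pos_le[OF full]) (use i that in auto)
  \<comment> \<open>Term \<open>k\<close> is the block of length \<open>k\<close> ending at
    \<open>Suc i\<close>, so the coefficients run backwards and the recurrence is
    \<open>continuant_front\<close>. Term \<open>2\<close> is the wanted minor.\<close>
  interpret trailing: sturm_sequence "\<lambda>k. K (Suc (Suc i) - k) k" "\<lambda>k. r (Suc i - k)"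
    "\<lambda>k. b (i - k)" "Suc (Suc i)"
  proof
    fix k t
    assume "Suc (Suc k) \<le> Suc (Suc i)"
    then show "K (Suc (Suc i) - Suc (Suc k)) (Suc (Suc k)) t =
        (r (Suc i - Suc k) + t) * K (Suc (Suc i) - Suc k) (Suc k) t
        - b (i - k) * K (Suc (Suc i) - k) k t"
      by (simp add: K_def continuant_front Suc_diff_le del: continuant.simps)
  qed (use b i in \<open>auto simp: K_def\<close>)
  have "0 < K i 2 t"
    using trailing.pos_le[of s 2 t] leading \<open>s \<le> t\<close> by simp
  then show ?thesis
    by (simp add: K_def b_def numeral_2_eq_2 mult.commute)
qed

lemma birth_death_row_bounds:
  assumes "birth_death_kernel d q r p P" and "i < d"
  shows "0 \<le> r i" "0 \<le> p i" "r i + p i \<le> 1"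
    "0 \<le> r (Suc i)" "0 \<le> q (Suc i)" "r (Suc i) + q (Suc i) \<le> 1"
proof -
  note nonneg = birth_death_kernelD(2)[OF assms(1)]
    and row_sum = birth_death_kernelD(3)[OF assms(1)] and ent = birth_death_kernelD(4)[OF assms(1)]
  have pair: "P $$ (k, j) + P $$ (k, l) \<le> 1" if "k \<le> d" "j \<le> d" "l \<le> d" "j \<noteq> l" for k j l
  proof -
    have "(\<Sum>x\<in>{j, l}. P $$ (k, x)) \<le> (\<Sum>x<Suc d. P $$ (k, x))"
      using that nonneg by (intro sum_mono2) auto
    also have "\<dots> = 1"
      using row_sum that by simp
    finally show ?thesis using that by simp
  qed
  show "0 \<le> r i" "0 \<le> p i" "0 \<le> r (Suc i)" "0 \<le> q (Suc i)"
    using nonneg[of i i] nonneg[of i "Suc i"] nonneg[of "Suc i" "Suc i"] nonneg[of "Suc i" i] assms(2)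
    by (simp_all add: ent)
  show "r i + p i \<le> 1" "r (Suc i) + q (Suc i) \<le> 1"
    using pair[of i i "Suc i"] pair[of "Suc i" "Suc i" i] assms(2) by (simp_all add: ent)
qed

text \<open>Only the cut \<open>j = i\<close> matters for rows \<open>i\<close> and
  \<open>Suc i\<close>: the tails there are \<open>p i\<close> and \<open>1 - q (Suc i)\<close>. For
  larger \<open>j\<close> the first tail is 0, for smaller \<open>j\<close> the second is 1.\<close>

lemma birth_death_monotoneI:
  assumes bd: "birth_death_kernel d q r p P" and le: "\<And>i. i < d \<Longrightarrow> p i + q (Suc i) \<le> 1"
  shows "monotone_kernel P"
proof -
  note P = birth_death_kernelD(1)[OF bd] and nonneg = birth_death_kernelD(2)[OF bd]
    and row_sum = birth_death_kernelD(3)[OF bd] and ent = birth_death_kernelD(4)[OF bd]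
  have split: "(\<Sum>k\<in>{..j}. P $$ (i, k)) + (\<Sum>k\<in>{j<..<Suc d}. P $$ (i, k)) = 1"
    if "i \<le> d" "j \<le> d" for i j
  proof -
    have "(\<Sum>k\<in>{..j}. P $$ (i, k)) + (\<Sum>k\<in>{j<..<Suc d}. P $$ (i, k)) = (\<Sum>k<Suc d. P $$ (i, k))"
      using that by (subst sum.union_disjoint[symmetric]) (auto intro!: sum.cong simp del: sum.lessThan_Suc)
    then show ?thesis
      using row_sum that by simp
  qed
  have tail_Suc: "(\<Sum>k\<in>{j<..<Suc d}. P $$ (i, k)) \<le> (\<Sum>k\<in>{j<..<Suc d}. P $$ (Suc i, k))"
    if ij: "i < d" "j \<le> d" for i j
  proof -
    consider "i < j" | "j = i" | "j < i" by linarith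
    then show ?thesis
    proof cases
      case 1
      then have "(\<Sum>k\<in>{j<..<Suc d}. P $$ (i, k)) = 0"
        using ij by (intro sum.neutral) (auto simp: ent)
      moreover have "0 \<le> (\<Sum>k\<in>{j<..<Suc d}. P $$ (Suc i, k))"
        using ij nonneg by (intro sum_nonneg) auto
      ultimately show ?thesis by simp
    next
      case 2
      have "(\<Sum>k\<in>{j<..<Suc d}. P $$ (i, k)) = (\<Sum>k\<in>{Suc i}. P $$ (i, k))"
        using ij 2 by (intro sum.mono_neutral_right) (auto simp: ent)
      moreover have "(\<Sum>k\<in>{..j}. P $$ (Suc i, k)) = (\<Sum>k\<in>{i}. P $$ (Suc i, k))"
        using ij 2 by (intro sum.mono_neutral_right) (auto simp: ent)
      ultimately show ?thesis
        using split[of "Suc i" j] le[of i] ij by (simp add: ent)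
    next
      case 3
      then have "(\<Sum>k\<in>{..j}. P $$ (Suc i, k)) = 0"
        using ij by (intro sum.neutral) (auto simp: ent)
      moreover have "0 \<le> (\<Sum>k\<in>{..j}. P $$ (i, k))"
        using ij nonneg by (intro sum_nonneg) auto
      ultimately show ?thesis
        using split[of i j] split[of "Suc i" j] ij by simp
    qed
  qed
  have "(\<Sum>k\<in>{j<..<Suc d}. P $$ (i, k)) \<le> (\<Sum>k\<in>{j<..<Suc d}. P $$ (i', k))"
    if "i \<le> i'" "i' \<le> d" "j \<le> d" for i i' j
    using that
  proof (induction rule: dec_induct)
    case (step k)
    then show ?case
      using tail_Suc[of k j] by simp
  qed simp
  then show ?thesis
    using P by (auto simp: monotone_kernel_def)
qed

theorem lemma2p4:
  fixes d :: nat and q r p :: "nat \<Rightarrow> real" and P :: "real mat"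
  assumes "birth_death_kernel d q r p P"
  shows "(has_positive_eigenvalues P \<longrightarrow> (\<forall>i \<in> {1..d}. p (i - 1) + q i < 1)) \<and>
         (has_nonneg_eigenvalues P \<longrightarrow> monotone_kernel P)"
proof (intro conjI impI ballI)
  fix i assume pos: "has_positive_eigenvalues P" and "i \<in> {1..d}"
  then obtain j where j: "i = Suc j" "j < d"
    by (cases i) auto
  note bounds = birth_death_row_bounds[OF assms j(2)]
  have "p j * q (Suc j) < (r j + 0) * (r (Suc j) + 0)"
    using pos by (intro birth_death_minor_pos[OF assms, of 0] j)
      (auto simp: has_positive_eigenvalues_def)
  also have "\<dots> \<le> (1 - p j) * (1 - q (Suc j))"
    using bounds by (intro mult_mono) auto
  \<comment> \<open>The product \<open>p j * q (Suc j)\<close> cancels, leaving a linear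
    inequality.\<close>
  finally show "p (i - 1) + q i < 1"
    by (simp add: j algebra_simps)
next
  assume nonneg: "has_nonneg_eigenvalues P"
  show "monotone_kernel P"
  proof (rule birth_death_monotoneI[OF assms])
    fix j assume j: "j < d"
    note bounds = birth_death_row_bounds[OF assms j]
    \<comment> \<open>Zero may be an eigenvalue here, so the strict bound is available only for
      \<open>t > 0\<close> and weakens in the limit.\<close>
    have minor: "p j * q (Suc j) < (r j + t) * (r (Suc j) + t)" if "0 < t" for t
      using nonneg that by (intro birth_death_minor_pos[OF assms, of t] j)
        (auto simp: has_nonneg_eigenvalues_def)
    have "((\<lambda>t. (r j + t) * (r (Suc j) + t)) \<longlongrightarrow> (r j + 0) * (r (Suc j) + 0)) (at_right 0)"
      by (intro tendsto_intros)
    then have "p j * q (Suc j) \<le> (r j + 0) * (r (Suc j) + 0)"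
      by (rule tendsto_lowerbound) (auto simp: eventually_at_filter minor less_imp_le)
    also have "\<dots> \<le> (1 - p j) * (1 - q (Suc j))"
      using bounds by (intro mult_mono) auto
    finally show "p j + q (Suc j) \<le> 1"
      by (simp add: algebra_simps)
  qed
qed

end
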